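(* Let $F$ be a singular fiber of Kodaira type $III^*$ of an elliptic fibration on a smooth $K3$ surface, written $$F=4C+2S_1+3M_1+2M_2+M_3+3L_1+2L_2+L_3.$$ Let $R$ be an ADER in $F$ with $C\not\subset\operatorname{Supp}(R)$. Then $R$ decomposes uniquely as a disjoint sum $$R=R_S+R_M+R_L,$$ where $R_S\in\{0,S_1\}$, and $R_M$ and $R_L$ are either zero or disjoint unions of mutually disjoint consecutive subchains of $M_1-M_2-M_3$ and $L_1-L_2-L_3$, respectively. (1) If $R_M\neq0$, then $R_M$ is of type $A_{\mu_1}\oplus\cdots\oplus A_{\mu_a}$ for some $\mu_1,\dots,\mu_a\geq1$ satisfying $\sum_{i=1}^a\mu_i+a-1\leq3$. (2) If $R_L\neq0$, then $R_L$ is of type $A_{\lambda_1}\oplus\cdots\oplus A_{\lambda_b}$ for some $\lambda_1,\dots,\lambda_b\geq1$ satisfying $\sum_{j=1}^b\lambda_j+b-1\leq3$. Conversely, every nonzero reduced subdivisor of $F$ of the form $R_S+R_M+R_L$, with $R_S\in\{0,S_1\}$, and with $R_M$ and $R_L$ each either zero or a disjoint union of mutually disjoint consecutive subchains of $M_1-M_2-M_3$ and $L_1-L_2-L_3$, respectively, satisfying (1) and (2), is an ADER.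
   Context: We work over an algebraically closed field of characteristic $0$. In a fiber of type $III^*$ all components are smooth rational $(-2)$-curves, meeting transversely in at most one point, with dual graph $\widetilde E_7$: the central vertex $C$ is the unique component meeting three others, and three branches start at $C$: $C-S_1$, $C-M_1-M_2-M_3$, and $C-L_1-L_2-L_3$. An ADE reduced divisor (ADER) in $F$ is a nonzero reduced subdivisor of $F$ (a sum of distinct components) whose dual graph is a disjoint union of Dynkin diagrams of type $A_k$, $D_l$ ($l\ge4$), $E_6,E_7,E_8$; its type is the type of this graph, with $\oplus$ denoting disjoint union. Mutually disjoint consecutive subchains are pairwise separated by at least one unused vertex. *)

theory Defs
  imports
    "HOL-Analysis.Abstract_Topology"
    "HOL-Computational_Algebra.Polynomial"
    "HOL-Library.Poly_Mapping"
    "HOL-Library.Extended_Nat"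
begin

text \<open>
  Projective varieties are treated as projective models in the sense of Zariski and Chevalley.
  The ground field is the type \<open>'k\<close>, the function field of the variety is the type \<open>'f\<close>, a
  \<open>'k\<close>-algebra by means of a field homomorphism \<open>\<iota> :: 'k \<Rightarrow> 'f\<close>. A closed point is identified with
  its local ring, a subset of \<open>'f\<close>; a variety is the set of its closed points, and a curve on it is
  a set of closed points.
\<close>

section \<open>Subrings of the function field\<close>

definition field_embedding :: "('k::field \<Rightarrow> 'f::field) \<Rightarrow> bool" where
  "field_embedding \<iota> \<longleftrightarrow>
     \<iota> 1 = 1 \<and> (\<forall>a b. \<iota> (a + b) = \<iota> a + \<iota> b) \<and> (\<forall>a b. \<iota> (a * b) = \<iota> a * \<iota> b)"

inductive_set generated_algebra :: "('k::field \<Rightarrow> 'f::field) \<Rightarrow> 'f set \<Rightarrow> 'f set"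
  for \<iota> :: "'k \<Rightarrow> 'f" and S :: "'f set" where
  const: "\<iota> c \<in> generated_algebra \<iota> S"
| gen: "s \<in> S \<Longrightarrow> s \<in> generated_algebra \<iota> S"
| add: "a \<in> generated_algebra \<iota> S \<Longrightarrow> b \<in> generated_algebra \<iota> S \<Longrightarrow> a + b \<in> generated_algebra \<iota> S"
| mult: "a \<in> generated_algebra \<iota> S \<Longrightarrow> b \<in> generated_algebra \<iota> S \<Longrightarrow> a * b \<in> generated_algebra \<iota> S"

definition fractions :: "'f::field set \<Rightarrow> 'f set" where
  "fractions A = {a / b | a b. a \<in> A \<and> b \<in> A \<and> b \<noteq> 0}"

definition ideal_in :: "'f::field set \<Rightarrow> 'f set \<Rightarrow> bool" where
  "ideal_in A I \<longleftrightarrow>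
     I \<subseteq> A \<and> 0 \<in> I \<and> (\<forall>a\<in>I. \<forall>b\<in>I. a + b \<in> I) \<and> (\<forall>r\<in>A. \<forall>a\<in>I. r * a \<in> I)"

definition maximal_ideal_in :: "'f::field set \<Rightarrow> 'f set \<Rightarrow> bool" where
  "maximal_ideal_in A I \<longleftrightarrow>
     ideal_in A I \<and> I \<noteq> A \<and> (\<forall>J. ideal_in A J \<and> I \<subseteq> J \<longrightarrow> J = I \<or> J = A)"

definition localization :: "'f::field set \<Rightarrow> 'f set \<Rightarrow> 'f set" where
  "localization A P = {a / b | a b. a \<in> A \<and> b \<in> A - P}"

definition units_in :: "'f::field set \<Rightarrow> 'f set" where
  "units_in A = {a \<in> A. a \<noteq> 0 \<and> inverse a \<in> A}"

text \<open>For a local ring this is its maximal ideal.\<close>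

definition nonunits :: "'f::field set \<Rightarrow> 'f set" where
  "nonunits A = A - units_in A"

definition algebraic_over :: "'f::field set \<Rightarrow> 'f \<Rightarrow> bool" where
  "algebraic_over L z \<longleftrightarrow> (\<exists>p. p \<noteq> 0 \<and> set (coeffs p) \<subseteq> L \<and> poly p z = 0)"

section \<open>Projective varieties\<close>

text \<open>
  For homogeneous coordinates \<open>x 0, \<dots>, x n\<close> in the function field, this is the coordinate ring of the
  standard affine chart on which the \<open>i\<close>-th coordinate does not vanish.
\<close>

definition chart_ring :: "('k::field \<Rightarrow> 'f::field) \<Rightarrow> nat \<Rightarrow> (nat \<Rightarrow> 'f) \<Rightarrow> nat \<Rightarrow> 'f set" where
  "chart_ring \<iota> n x i = generated_algebra \<iota> {x j / x i | j. j \<le> n}"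

definition projective_variety :: "('k::field \<Rightarrow> 'f::field) \<Rightarrow> 'f set set \<Rightarrow> bool" where
  "projective_variety \<iota> X \<longleftrightarrow>
     (\<exists>n x. (\<exists>i\<le>n. x i \<noteq> 0) \<and>
            (\<forall>i\<le>n. x i \<noteq> 0 \<longrightarrow> fractions (chart_ring \<iota> n x i) = UNIV) \<and>
            X = {localization (chart_ring \<iota> n x i) m | i m.
                   i \<le> n \<and> x i \<noteq> 0 \<and> maximal_ideal_in (chart_ring \<iota> n x i) m})"

text \<open>The transcendence degree of the function field over the ground field is 2.\<close>

definition two_dimensional :: "('k::field \<Rightarrow> 'f::field) \<Rightarrow> bool" where
  "two_dimensional \<iota> \<longleftrightarrow>
     (\<exists>u v. \<not> algebraic_over (range \<iota>) u \<and>
            \<not> algebraic_over (fractions (generated_algebra \<iota> {u})) v \<and>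
            (\<forall>z. algebraic_over (fractions (generated_algebra \<iota> {u, v})) z))"

definition local_parameters :: "'f::field set \<Rightarrow> 'f \<Rightarrow> 'f \<Rightarrow> bool" where
  "local_parameters p u v \<longleftrightarrow> nonunits p = {a * u + b * v | a b. a \<in> p \<and> b \<in> p}"

text \<open>
  The local rings of a surface at closed points have dimension 2, so they are regular exactly when
  the maximal ideal has two generators; over an algebraically closed field this is smoothness.
\<close>

definition smooth_projective_surface :: "('k::field \<Rightarrow> 'f::field) \<Rightarrow> 'f set set \<Rightarrow> bool" where
  "smooth_projective_surface \<iota> X \<longleftrightarrow>
     projective_variety \<iota> X \<and> two_dimensional \<iota> \<and> (\<forall>p\<in>X. \<exists>u v. local_parameters p u v)"

text \<open>
  The domains of definition of rational functions are Zariski open, and their finite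
  intersections include the standard basic open subsets of the affine charts.
\<close>

definition zariski :: "'f::field set set \<Rightarrow> 'f set topology" where
  "zariski X = topology_generated_by {{p \<in> X. f \<in> p} | f. True}"

text \<open>Value at a closed point of a function regular there; the residue field is the ground field.\<close>

definition value_at :: "('k::field \<Rightarrow> 'f::field) \<Rightarrow> 'f \<Rightarrow> 'f set \<Rightarrow> 'k" where
  "value_at \<iota> f p = (THE c. f - \<iota> c \<in> nonunits p)"

section \<open>Cohomology of the structure sheaf\<close>

text \<open>
  A closed subset \<open>Z\<close> carries its reduced structure: its regular functions are the functions with
  values in the ground field that locally are restrictions of regular functions on \<open>X\<close>.
\<close>

definition regular_on ::
    "('k::field \<Rightarrow> 'f::field) \<Rightarrow> 'f set set \<Rightarrow> 'f set set \<Rightarrow> 'f set set \<Rightarrow> ('f set \<Rightarrow> 'k) \<Rightarrow> bool" where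
  "regular_on \<iota> X Z U \<phi> \<longleftrightarrow>
     (\<forall>p \<in> Z \<inter> U. \<exists>f V. openin (zariski X) V \<and> p \<in> V \<and>
        (\<forall>q \<in> Z \<inter> U \<inter> V. f \<in> q \<and> \<phi> q = value_at \<iota> f q))"

definition open_cover :: "'f::field set set \<Rightarrow> 'f set set \<Rightarrow> nat \<Rightarrow> (nat \<Rightarrow> 'f set set) \<Rightarrow> bool" where
  "open_cover X Z m U \<longleftrightarrow> (\<forall>i<m. openin (zariski X) (U i)) \<and> Z \<subseteq> (\<Union>i<m. U i)"

definition cech_cocycle ::
    "('k::field \<Rightarrow> 'f::field) \<Rightarrow> 'f set set \<Rightarrow> 'f set set \<Rightarrow> nat \<Rightarrow> (nat \<Rightarrow> 'f set set) \<Rightarrow>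
     (nat \<Rightarrow> nat \<Rightarrow> 'f set \<Rightarrow> 'k) \<Rightarrow> bool" where
  "cech_cocycle \<iota> X Z m U g \<longleftrightarrow>
     (\<forall>i<m. \<forall>j<m. regular_on \<iota> X Z (U i \<inter> U j) (g i j)) \<and>
     (\<forall>i<m. \<forall>j<m. \<forall>l<m. \<forall>p \<in> Z \<inter> U i \<inter> U j \<inter> U l. g i l p = g i j p + g j l p)"

definition cech_coboundary ::
    "('k::field \<Rightarrow> 'f::field) \<Rightarrow> 'f set set \<Rightarrow> 'f set set \<Rightarrow> nat \<Rightarrow> (nat \<Rightarrow> 'f set set) \<Rightarrow>
     (nat \<Rightarrow> nat \<Rightarrow> 'f set \<Rightarrow> 'k) \<Rightarrow> bool" where
  "cech_coboundary \<iota> X Z m U g \<longleftrightarrow>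
     (\<exists>h. (\<forall>i<m. regular_on \<iota> X Z (U i) (h i)) \<and>
          (\<forall>i<m. \<forall>j<m. \<forall>p \<in> Z \<inter> U i \<inter> U j. g i j p = h i p - h j p))"

text \<open>
  The dimension of \<open>H\<^sup>1(Z, \<O>\<^sub>Z)\<close>. This group is the directed union of the first Cech cohomology groups
  of open covers (in degree 1 the transition maps are injective, and finite covers are cofinal), so
  its dimension is the largest number of cocycles on one cover that are linearly independent modulo
  coboundaries.
\<close>

definition h1 :: "('k::field \<Rightarrow> 'f::field) \<Rightarrow> 'f set set \<Rightarrow> 'f set set \<Rightarrow> enat" where
  "h1 \<iota> X Z = Sup {enat d | d m U g.
     open_cover X Z m U \<and> (\<forall>e<d. cech_cocycle \<iota> X Z m U (g e)) \<and>
     (\<forall>c. cech_coboundary \<iota> X Z m U (\<lambda>i j p. \<Sum>e<d. c e * g e i j p) \<longrightarrow> (\<forall>e<d. c e = 0))}"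

section \<open>K3 surfaces\<close>

definition derivation :: "('k::field \<Rightarrow> 'f::field) \<Rightarrow> ('f \<Rightarrow> 'f) \<Rightarrow> bool" where
  "derivation \<iota> D \<longleftrightarrow>
     (\<forall>a b. D (a + b) = D a + D b) \<and> (\<forall>a b. D (a * b) = a * D b + D a * b) \<and> (\<forall>c. D (\<iota> c) = 0)"

text \<open>
  Rational 2-forms are alternating bilinear forms on the derivations of the function field, the form
  \<open>du \<and> dv\<close> being \<open>(D\<^sub>1, D\<^sub>2) \<mapsto> D\<^sub>1 u D\<^sub>2 v - D\<^sub>1 v D\<^sub>2 u\<close>. If \<open>u, v\<close> are local parameters at \<open>p\<close>, then \<open>du \<and> dv\<close>
  generates the stalk of the canonical sheaf at \<open>p\<close>. The canonical sheaf is trivial if some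
  rational 2-form \<open>\<omega>\<close> generates all of its stalks.
\<close>

definition trivial_canonical_sheaf :: "('k::field \<Rightarrow> 'f::field) \<Rightarrow> 'f set set \<Rightarrow> bool" where
  "trivial_canonical_sheaf \<iota> X \<longleftrightarrow>
     (\<exists>\<omega>. \<forall>p\<in>X. \<exists>u v h. local_parameters p u v \<and> h \<in> units_in p \<and>
        (\<forall>D1 D2. derivation \<iota> D1 \<and> derivation \<iota> D2 \<longrightarrow>
           \<omega> D1 D2 = h * (D1 u * D2 v - D1 v * D2 u)))"

definition K3_surface :: "('k::field \<Rightarrow> 'f::field) \<Rightarrow> 'f set set \<Rightarrow> bool" where
  "K3_surface \<iota> X \<longleftrightarrow>
     smooth_projective_surface \<iota> X \<and> trivial_canonical_sheaf \<iota> X \<and> h1 \<iota> X X = 0"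

section \<open>Curves and divisors on a surface\<close>

definition irreducible_closed :: "'f::field set set \<Rightarrow> 'f set set \<Rightarrow> bool" where
  "irreducible_closed X Z \<longleftrightarrow>
     closedin (zariski X) Z \<and> Z \<noteq> {} \<and>
     (\<forall>A B. closedin (zariski X) A \<and> closedin (zariski X) B \<and> Z = A \<union> B \<longrightarrow> Z = A \<or> Z = B)"

text \<open>On a surface, the irreducible closed subsets are the surface, the curves and the points.\<close>

definition curves :: "'f::field set set \<Rightarrow> 'f set set set" where
  "curves X = {D. irreducible_closed X D \<and> D \<noteq> X \<and> (\<nexists>p. D = {p})}"

text \<open>
  The local ring of the surface along a curve \<open>D\<close>, that is, at its generic point: a rational function
  is regular at the generic point iff it is regular at some closed point of \<open>D\<close>.
\<close>

definition ring_along :: "'f::field set set \<Rightarrow> 'f set" where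
  "ring_along D = \<Union>D"

definition ord_along :: "'f::field set set \<Rightarrow> 'f \<Rightarrow> int" where
  "ord_along D f = (THE n. \<exists>\<pi> u. nonunits (ring_along D) = {a * \<pi> | a. a \<in> ring_along D} \<and>
     u \<in> units_in (ring_along D) \<and> f = u * \<pi> powi n)"

text \<open>The stalk at a point \<open>p\<close> of the ideal sheaf of a curve \<open>D\<close> through \<open>p\<close>.\<close>

definition ideal_at :: "'f::field set set \<Rightarrow> 'f set \<Rightarrow> 'f set" where
  "ideal_at D p = p \<inter> nonunits (ring_along D)"

definition ideal_sum :: "'f::field set \<Rightarrow> 'f set \<Rightarrow> 'f set" where
  "ideal_sum I J = {a + b | a b. a \<in> I \<and> b \<in> J}"

definition smooth_curve :: "'f::field set set \<Rightarrow> bool" where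
  "smooth_curve D \<longleftrightarrow>
     (\<forall>p\<in>D. \<exists>u v. local_parameters p u v \<and> ideal_at D p = {a * u | a. a \<in> p})"

text \<open>The function field of \<open>D\<close>, which is the residue field of the ring along \<open>D\<close>, is \<open>k(s)\<close>.\<close>

definition rational_curve :: "('k::field \<Rightarrow> 'f::field) \<Rightarrow> 'f set set \<Rightarrow> bool" where
  "rational_curve \<iota> D \<longleftrightarrow>
     (\<exists>s \<in> ring_along D. \<forall>f \<in> ring_along D.
        \<exists>a \<in> generated_algebra \<iota> {s}. \<exists>b \<in> generated_algebra \<iota> {s}.
          b \<notin> nonunits (ring_along D) \<and> f - a / b \<in> nonunits (ring_along D))"

text \<open>The dimension of \<open>p / I\<close> over the ground field, for an ideal \<open>I\<close> of finite colength.\<close>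

definition colength :: "('k::field \<Rightarrow> 'f::field) \<Rightarrow> 'f set \<Rightarrow> 'f set \<Rightarrow> nat" where
  "colength \<iota> p I = (GREATEST d. \<exists>b. (\<forall>i<d. b i \<in> p) \<and>
     (\<forall>c. (\<Sum>i<d. \<iota> (c i) * b i) \<in> I \<longrightarrow> (\<forall>i<d. c i = 0)))"

text \<open>The intersection number of two distinct curves.\<close>

definition intersection_number ::
    "('k::field \<Rightarrow> 'f::field) \<Rightarrow> 'f set set \<Rightarrow> 'f set set \<Rightarrow> nat" where
  "intersection_number \<iota> D E =
     (\<Sum>p \<in> D \<inter> E. colength \<iota> p (ideal_sum (ideal_at D p) (ideal_at E p)))"

text \<open>
  If \<open>f\<close> has order 1 along \<open>D\<close>, then \<open>D\<close> is linearly equivalent to \<open>D - div f\<close>, which does not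
  contain \<open>D\<close>; hence \<open>D\<^sup>2 = (D - div f) \<cdot> D\<close>.
\<close>

definition self_intersection :: "('k::field \<Rightarrow> 'f::field) \<Rightarrow> 'f set set \<Rightarrow> 'f set set \<Rightarrow> int" where
  "self_intersection \<iota> X D = (THE n. \<forall>f. f \<noteq> 0 \<and> ord_along D f = 1 \<longrightarrow>
     n = - (\<Sum>E \<in> {E \<in> curves X. E \<noteq> D \<and> ord_along E f \<noteq> 0}.
              ord_along E f * int (intersection_number \<iota> D E)))"

definition smooth_rational_minus_two_curve ::
    "('k::field \<Rightarrow> 'f::field) \<Rightarrow> 'f set set \<Rightarrow> 'f set set \<Rightarrow> bool" where
  "smooth_rational_minus_two_curve \<iota> X D \<longleftrightarrow>
     D \<in> curves X \<and> smooth_curve D \<and> rational_curve \<iota> D \<and> self_intersection \<iota> X D = -2"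

definition meet_transversely_at_most_once :: "'f::field set set \<Rightarrow> 'f set set \<Rightarrow> bool" where
  "meet_transversely_at_most_once D E \<longleftrightarrow>
     (\<forall>p \<in> D \<inter> E. D \<inter> E = {p} \<and> ideal_sum (ideal_at D p) (ideal_at E p) = nonunits p)"

text \<open>Divisors are formal integral combinations of curves.\<close>

type_synonym 'f divisor = "'f set set \<Rightarrow>\<^sub>0 int"

abbreviation prime_divisor :: "'f set set \<Rightarrow> 'f divisor" where
  "prime_divisor D \<equiv> Poly_Mapping.single D 1"

definition Supp :: "'f divisor \<Rightarrow> 'f set set" where
  "Supp R = \<Union> (Poly_Mapping.keys R)"

text \<open>A sum of distinct components of \<open>F\<close>.\<close>

definition reduced_subdivisor :: "'f divisor \<Rightarrow> 'f divisor \<Rightarrow> bool" where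
  "reduced_subdivisor R F \<longleftrightarrow> (\<exists>B \<subseteq> Poly_Mapping.keys F. R = (\<Sum>D\<in>B. prime_divisor D))"

section \<open>Elliptic fibrations\<close>

text \<open>
  A nonconstant morphism from \<open>X\<close> to the projective line is a nonconstant rational function \<open>t\<close> such
  that \<open>t\<close> or \<open>1/t\<close> is regular at each point. The points of the line are \<open>Some a\<close> and \<open>None\<close>
  (infinity).
\<close>

fun base_parameter :: "('k::field \<Rightarrow> 'f::field) \<Rightarrow> 'f \<Rightarrow> 'k option \<Rightarrow> 'f" where
  "base_parameter \<iota> t (Some a) = t - \<iota> a"
| "base_parameter \<iota> t None = inverse t"

text \<open>\<open>F\<close> is the scheme-theoretic fiber over \<open>b\<close>, as an effective divisor.\<close>

definition is_fiber ::
    "('k::field \<Rightarrow> 'f::field) \<Rightarrow> 'f set set \<Rightarrow> 'f \<Rightarrow> 'k option \<Rightarrow> 'f divisor \<Rightarrow> bool" where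
  "is_fiber \<iota> X t b F \<longleftrightarrow> Poly_Mapping.keys F \<subseteq> curves X \<and>
     (\<forall>D \<in> curves X. Poly_Mapping.lookup F D = max 0 (ord_along D (base_parameter \<iota> t b)))"

definition smooth_fiber :: "'f::field divisor \<Rightarrow> bool" where
  "smooth_fiber F \<longleftrightarrow> (\<exists>E. F = prime_divisor E \<and> smooth_curve E)"

text \<open>All but finitely many fibers are smooth irreducible curves of genus 1.\<close>

definition elliptic_fibration :: "('k::field \<Rightarrow> 'f::field) \<Rightarrow> 'f set set \<Rightarrow> 'f \<Rightarrow> bool" where
  "elliptic_fibration \<iota> X t \<longleftrightarrow>
     t \<notin> range \<iota> \<and> (\<forall>p\<in>X. t \<in> p \<or> inverse t \<in> p) \<and>
     finite {b. \<not> (\<exists>E. is_fiber \<iota> X t b (prime_divisor E) \<and> smooth_curve E \<and> h1 \<iota> X E = 1)}"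

definition singular_fiber ::
    "('k::field \<Rightarrow> 'f::field) \<Rightarrow> 'f set set \<Rightarrow> 'f \<Rightarrow> 'f divisor \<Rightarrow> bool" where
  "singular_fiber \<iota> X t F \<longleftrightarrow> (\<exists>b. is_fiber \<iota> X t b F) \<and> \<not> smooth_fiber F"

section \<open>Graphs and Dynkin diagrams\<close>

text \<open>A graph is a vertex set with an adjacency relation, which is relevant on the vertex set only.\<close>

type_synonym 'v graph = "'v set \<times> ('v \<Rightarrow> 'v \<Rightarrow> bool)"

definition graph_iso :: "'v graph \<Rightarrow> 'w graph \<Rightarrow> bool" where
  "graph_iso G H \<longleftrightarrow>
     (\<exists>f. bij_betw f (fst G) (fst H) \<and>
          (\<forall>x \<in> fst G. \<forall>y \<in> fst G. snd G x y \<longleftrightarrow> snd H (f x) (f y)))"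

datatype dynkin = DynA nat | DynD nat | DynE nat

fun valid_dynkin :: "dynkin \<Rightarrow> bool" where
  "valid_dynkin (DynA k) \<longleftrightarrow> k \<ge> 1"
| "valid_dynkin (DynD l) \<longleftrightarrow> l \<ge> 4"
| "valid_dynkin (DynE m) \<longleftrightarrow> m \<in> {6, 7, 8}"

fun dynkin_rank :: "dynkin \<Rightarrow> nat" where
  "dynkin_rank (DynA k) = k"
| "dynkin_rank (DynD l) = l"
| "dynkin_rank (DynE m) = m"

text \<open>
  The vertices are \<open>0, \<dots>, n - 1\<close>, where \<open>n\<close> is the rank, and each edge is listed once. Types D and E
  consist of the path \<open>0, \<dots>, n - 2\<close> and the vertex \<open>n - 1\<close>, attached to the vertex \<open>n - 3\<close> in type D
  and to the vertex \<open>2\<close> in type E.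
\<close>

fun dynkin_edges :: "dynkin \<Rightarrow> (nat \<times> nat) set" where
  "dynkin_edges (DynA k) = {(i, i + 1) | i. i + 1 < k}"
| "dynkin_edges (DynD l) = {(i, i + 1) | i. i + 1 < l - 1} \<union> {(l - 3, l - 1)}"
| "dynkin_edges (DynE m) = {(i, i + 1) | i. i + 1 < m - 1} \<union> {(2, m - 1)}"

definition dynkin_graph :: "dynkin \<Rightarrow> nat graph" where
  "dynkin_graph T =
     ({..<dynkin_rank T}, \<lambda>i j. (i, j) \<in> dynkin_edges T \<or> (j, i) \<in> dynkin_edges T)"

definition disjoint_union_graph :: "'v graph list \<Rightarrow> (nat \<times> 'v) graph" where
  "disjoint_union_graph Gs =
     ({(n, v). n < length Gs \<and> v \<in> fst (Gs ! n)},
      \<lambda>(n, v) (m, w). n = m \<and> snd (Gs ! n) v w)"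

definition dual_graph :: "'f divisor \<Rightarrow> 'f set set graph" where
  "dual_graph R = (Poly_Mapping.keys R, \<lambda>D E. D \<noteq> E \<and> D \<inter> E \<noteq> {})"

text \<open>The list \<open>[T\<^sub>1, \<dots>, T\<^sub>m]\<close> stands for the type \<open>T\<^sub>1 \<oplus> \<dots> \<oplus> T\<^sub>m\<close>.\<close>

definition has_type :: "'f divisor \<Rightarrow> dynkin list \<Rightarrow> bool" where
  "has_type R Ts \<longleftrightarrow> (\<forall>T \<in> set Ts. valid_dynkin T) \<and>
     graph_iso (dual_graph R) (disjoint_union_graph (map dynkin_graph Ts))"

definition ADER :: "'f divisor \<Rightarrow> 'f divisor \<Rightarrow> bool" where
  "ADER F R \<longleftrightarrow> R \<noteq> 0 \<and> reduced_subdivisor R F \<and> (\<exists>Ts. has_type R Ts)"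

section \<open>Fibers of type III*\<close>

definition type_III_star ::
    "('k::field \<Rightarrow> 'f::field) \<Rightarrow> 'f set set \<Rightarrow> 'f divisor \<Rightarrow> 'f set set \<Rightarrow> 'f set set \<Rightarrow>
     'f set set \<Rightarrow> 'f set set \<Rightarrow> 'f set set \<Rightarrow> 'f set set \<Rightarrow> 'f set set \<Rightarrow> 'f set set \<Rightarrow> bool" where
  "type_III_star \<iota> X F C S1 M1 M2 M3 L1 L2 L3 \<longleftrightarrow>
     distinct [C, S1, M1, M2, M3, L1, L2, L3] \<and>
     F = Poly_Mapping.single C 4 + Poly_Mapping.single S1 2
       + Poly_Mapping.single M1 3 + Poly_Mapping.single M2 2 + Poly_Mapping.single M3 1
       + Poly_Mapping.single L1 3 + Poly_Mapping.single L2 2 + Poly_Mapping.single L3 1 \<and>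
     (\<forall>D \<in> Poly_Mapping.keys F. smooth_rational_minus_two_curve \<iota> X D) \<and>
     (\<forall>D \<in> Poly_Mapping.keys F. \<forall>E \<in> Poly_Mapping.keys F. D \<noteq> E \<longrightarrow> meet_transversely_at_most_once D E) \<and>
     (\<forall>D \<in> Poly_Mapping.keys F. \<forall>E \<in> Poly_Mapping.keys F. snd (dual_graph F) D E \<longleftrightarrow>
        {D, E} \<in> {{C, S1}, {C, M1}, {M1, M2}, {M2, M3}, {C, L1}, {L1, L2}, {L2, L3}})"

section \<open>Unions of subchains\<close>

text \<open>
  A nonempty consecutive subchain of a chain of curves \<open>xs\<close> is given by a pair \<open>(i, j)\<close> with
  \<open>i < j \<le> length xs\<close> and consists of the entries at the positions \<open>i, \<dots>, j - 1\<close>. The subchains are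
  listed in the order in which they occur in \<open>xs\<close>; the vertex at position \<open>j\<close> separates \<open>(i, j)\<close> from
  the later ones and is unused.
\<close>

definition separated_subchains :: "'c list \<Rightarrow> (nat \<times> nat) list \<Rightarrow> bool" where
  "separated_subchains xs Q \<longleftrightarrow>
     (\<forall>(i, j) \<in> set Q. i < j \<and> j \<le> length xs) \<and> sorted_wrt (\<lambda>(i, j) (i', j'). j < i') Q"

definition subchain_union :: "'f set set list \<Rightarrow> 'f divisor \<Rightarrow> bool" where
  "subchain_union xs R \<longleftrightarrow>
     (\<exists>Q. Q \<noteq> [] \<and> separated_subchains xs Q \<and>
          R = (\<Sum>(i, j)\<leftarrow>Q. \<Sum>v=i..<j. prime_divisor (xs ! v)))"

definition branch_parts ::
    "'f set set \<Rightarrow> 'f set set list \<Rightarrow> 'f set set list \<Rightarrow> 'f divisor \<Rightarrow> 'f divisor \<Rightarrow> 'f divisor \<Rightarrow> bool"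
  where
  "branch_parts S1 Ms Ls RS RM RL \<longleftrightarrow>
     RS \<in> {0, prime_divisor S1} \<and>
     (RM = 0 \<or> subchain_union Ms RM) \<and> (RL = 0 \<or> subchain_union Ls RL)"

text \<open>A decomposition into parts of the above form, the parts being pairwise disjoint as curves.\<close>

definition decomposition ::
    "'f set set \<Rightarrow> 'f set set list \<Rightarrow> 'f set set list \<Rightarrow> 'f divisor \<Rightarrow>
     'f divisor \<times> 'f divisor \<times> 'f divisor \<Rightarrow> bool" where
  "decomposition S1 Ms Ls R = (\<lambda>(RS, RM, RL).
     R = RS + RM + RL \<and> branch_parts S1 Ms Ls RS RM RL \<and>
     Supp RS \<inter> Supp RM = {} \<and> Supp RS \<inter> Supp RL = {} \<and> Supp RM \<inter> Supp RL = {})"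

text \<open>\<open>P\<close> is of type \<open>A\<^bsub>\<mu>\<^sub>1\<^esub> \<oplus> \<dots> \<oplus> A\<^bsub>\<mu>\<^sub>a\<^esub>\<close> with \<open>a, \<mu>\<^sub>i \<ge> 1\<close> and \<open>\<mu>\<^sub>1 + \<dots> + \<mu>\<^sub>a + a - 1 \<le> 3\<close>.\<close>

definition bounded_A_type :: "'f divisor \<Rightarrow> bool" where
  "bounded_A_type P \<longleftrightarrow>
     (\<exists>\<mu>. \<mu> \<noteq> [] \<and> (\<forall>m \<in> set \<mu>. m \<ge> 1) \<and> has_type P (map DynA \<mu>) \<and>
          sum_list \<mu> + length \<mu> - 1 \<le> 3)"

end

theory Submission
  imports Defs
begin

text \<open>
  Removing \<open>C\<close> cuts the dual graph into the isolated vertex \<open>S\<^sub>1\<close> and two paths with three vertices, so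
  everything reduces to paths. A set of vertices of a path splits into its maximal runs of consecutive
  vertices; a run of length \<open>k\<close> is a diagram \<open>A\<^sub>k\<close>, and each run but the last uses up one further
  vertex as separator, which gives the numerical bound. Diagrams of parts that do not meet
  are juxtaposed.
\<close>

section \<open>Graphs\<close>

lemma graph_iso_sym:
  assumes "graph_iso G H"
  shows "graph_iso H G"
proof -
  obtain f where f: "bij_betw f (fst G) (fst H)"
      "\<And>x y. x \<in> fst G \<Longrightarrow> y \<in> fst G \<Longrightarrow> snd G x y \<longleftrightarrow> snd H (f x) (f y)"
    using assms unfolding graph_iso_def by blast
  have g: "bij_betw (inv_into (fst G) f) (fst H) (fst G)"
    using f(1) by (rule bij_betw_inv_into)
  have "snd H x y \<longleftrightarrow> snd G (inv_into (fst G) f x) (inv_into (fst G) f y)"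
    if "x \<in> fst H" "y \<in> fst H" for x y
    using that f(2)[of "inv_into (fst G) f x" "inv_into (fst G) f y"]
      bij_betw_apply[OF g] bij_betw_inv_into_right[OF f(1)] by simp
  with g show ?thesis
    unfolding graph_iso_def by blast
qed

text \<open>The two isomorphisms are glued, the second one after shifting its summand indices past
  those of \<open>Gs\<close>. Edges between \<open>V\<close> and \<open>W\<close> are excluded on
  one side by hypothesis, and on the other because vertices in summands of different index are never
  adjacent.\<close>

lemma graph_iso_disjoint_union_append:
  assumes iso1: "graph_iso (V, E) (disjoint_union_graph Gs)"
    and iso2: "graph_iso (W, E) (disjoint_union_graph Hs)"
    and disj: "V \<inter> W = {}"
    and no_edges: "\<And>x y. x \<in> V \<Longrightarrow> y \<in> W \<Longrightarrow> \<not> E x y \<and> \<not> E y x"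
  shows "graph_iso (V \<union> W, E) (disjoint_union_graph (Gs @ Hs))"
proof -
  define dV where "dV Ks = {(n, v). n < length Ks \<and> v \<in> fst (Ks ! n)}" for Ks :: "'b graph list"
  define dE where "dE Ks = (\<lambda>(n, v) (m, w). n = m \<and> snd (Ks ! n) v w)" for Ks :: "'b graph list"
  have du: "disjoint_union_graph Ks = (dV Ks, dE Ks)" for Ks :: "'b graph list"
    by (simp add: disjoint_union_graph_def dV_def dE_def)
  obtain f where f: "bij_betw f V (dV Gs)"
      "\<And>x y. x \<in> V \<Longrightarrow> y \<in> V \<Longrightarrow> E x y \<longleftrightarrow> dE Gs (f x) (f y)"
    using iso1 unfolding graph_iso_def du by auto
  obtain g where g: "bij_betw g W (dV Hs)"
      "\<And>x y. x \<in> W \<Longrightarrow> y \<in> W \<Longrightarrow> E x y \<longleftrightarrow> dE Hs (g x) (g y)"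
    using iso2 unfolding graph_iso_def du by auto
  \<comment> \<open>In \<open>Gs @ Hs\<close> the summand of index \<open>n\<close> of
    \<open>Hs\<close> has index \<open>n + length Gs\<close>.\<close>
  define s where "s = (\<lambda>(n, v :: 'b). (n + length Gs, v))"
  define h where "h x = (if x \<in> V then f x else s (g x))" for x
  have s: "bij_betw s (dV Hs) (s ` dV Hs)"
    by (auto simp: s_def inj_on_def intro!: inj_on_imp_bij_betw)
  have union: "dV (Gs @ Hs) = dV Gs \<union> s ` dV Hs"
  proof (intro subset_antisym subsetI)
    fix p assume p: "p \<in> dV (Gs @ Hs)"
    obtain n v where nv: "p = (n, v)" by fastforce
    show "p \<in> dV Gs \<union> s ` dV Hs"
    proof (cases "n < length Gs")
      case True
      then show ?thesis using p by (simp add: nv dV_def nth_append)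
    next
      case False
      then have "p = s (n - length Gs, v)" "(n - length Gs, v) \<in> dV Hs"
        using p by (auto simp: nv s_def dV_def nth_append)
      then show ?thesis by blast
    qed
  qed (auto simp: dV_def s_def nth_append)
  have disj': "dV Gs \<inter> s ` dV Hs = {}"
    by (auto simp: dV_def s_def)
  have hV: "bij_betw h V (dV Gs)"
    using f(1) by (rule bij_betw_cong[THEN iffD1, rotated]) (simp add: h_def)
  have hW: "bij_betw h W (s ` dV Hs)"
    using bij_betw_trans[OF g(1) s] by (rule bij_betw_cong[THEN iffD1, rotated])
      (use disj in \<open>auto simp: h_def\<close>)
  have bij: "bij_betw h (V \<union> W) (dV (Gs @ Hs))"
    unfolding union using hV hW disj' by (rule bij_betw_combine)
  have edges: "E x y \<longleftrightarrow> dE (Gs @ Hs) (h x) (h y)" if "x \<in> V \<union> W" "y \<in> V \<union> W" for x y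
  proof -
    have VV: "dE (Gs @ Hs) p q \<longleftrightarrow> dE Gs p q" if "p \<in> dV Gs" "q \<in> dV Gs" for p q
      using that by (auto simp: dE_def dV_def nth_append)
    have WW: "dE (Gs @ Hs) (s p) (s q) \<longleftrightarrow> dE Hs p q" for p q
      by (auto simp: dE_def s_def nth_append split: prod.splits)
    have VW: "\<not> dE (Gs @ Hs) p (s q) \<and> \<not> dE (Gs @ Hs) (s q) p" if "p \<in> dV Gs" for p q
      using that by (auto simp: dE_def dV_def s_def split: prod.splits)
    have h_V: "h z = f z" "f z \<in> dV Gs" if "z \<in> V" for z
      using that bij_betw_apply[OF f(1)] by (auto simp: h_def)
    have h_W: "h z = s (g z)" if "z \<in> W" for z
      using that disj by (auto simp: h_def)
    from that consider "x \<in> V" "y \<in> V" | "x \<in> V" "y \<in> W" | "x \<in> W" "y \<in> V" | "x \<in> W" "y \<in> W"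
      by blast
    then show ?thesis
      by cases (simp_all add: h_V h_W VV WW VW f(2) g(2) no_edges)
  qed
  show ?thesis
    unfolding graph_iso_def du using bij edges by auto
qed

section \<open>Types of divisors\<close>

lemma keys_sum_prime_divisor:
  assumes "finite B"
  shows "Poly_Mapping.keys (\<Sum>D\<in>B. prime_divisor D) = B"
proof -
  have "Poly_Mapping.lookup (\<Sum>D\<in>B. prime_divisor D) E = of_bool (E \<in> B)" for E
    using assms by (simp add: lookup_sum lookup_single when_def)
  then show ?thesis
    by (auto simp: in_keys_iff)
qed

lemma keys_sum_prime_divisor_inj:
  assumes "finite I" "inj_on g I"
  shows "Poly_Mapping.keys (\<Sum>v\<in>I. prime_divisor (g v)) = g ` I"
  using keys_sum_prime_divisor[of "g ` I"] assms by (simp add: sum.reindex)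

text \<open>At every point one of the two coefficients vanishes, so nothing can cancel.\<close>

lemma keys_add_disjoint:
  fixes P Q :: "'a \<Rightarrow>\<^sub>0 'b::monoid_add"
  assumes "Poly_Mapping.keys P \<inter> Poly_Mapping.keys Q = {}"
  shows "Poly_Mapping.keys (P + Q) = Poly_Mapping.keys P \<union> Poly_Mapping.keys Q"
proof -
  have "D \<in> Poly_Mapping.keys (P + Q) \<longleftrightarrow> D \<in> Poly_Mapping.keys P \<union> Poly_Mapping.keys Q" for D
  proof -
    have "Poly_Mapping.lookup P D = 0 \<or> Poly_Mapping.lookup Q D = 0"
      using assms by (auto simp: in_keys_iff)
    then show ?thesis
      by (auto simp: in_keys_iff lookup_add)
  qed
  then show ?thesis
    by blast
qed

text \<open>The empty list is the type of an absent part, so that zero and nonzero parts can be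
  added uniformly.\<close>

lemma has_type_zero: "has_type 0 []"
  by (simp add: has_type_def graph_iso_def dual_graph_def disjoint_union_graph_def bij_betw_def)

text \<open>Juxtaposition of diagrams for parts that do not meet. Disjointness of the key sets is a
  separate hypothesis: keys are arbitrary sets here, and an empty common key would satisfy the other
  one.\<close>

lemma has_type_add:
  assumes P: "has_type P Ts" and Q: "has_type Q Us"
    and disj: "Poly_Mapping.keys P \<inter> Poly_Mapping.keys Q = {}"
    and apart: "\<And>D E. D \<in> Poly_Mapping.keys P \<Longrightarrow> E \<in> Poly_Mapping.keys Q \<Longrightarrow> D \<inter> E = {}"
  shows "has_type (P + Q) (Ts @ Us)"
proof -
  have "graph_iso (Poly_Mapping.keys P \<union> Poly_Mapping.keys Q, \<lambda>D E. D \<noteq> E \<and> D \<inter> E \<noteq> {})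
      (disjoint_union_graph (map dynkin_graph Ts @ map dynkin_graph Us))"
    by (rule graph_iso_disjoint_union_append)
      (use assms in \<open>auto simp: has_type_def dual_graph_def\<close>)
  then show ?thesis
    using P Q by (auto simp: has_type_def dual_graph_def keys_add_disjoint[OF disj])
qed

section \<open>Chains of curves\<close>

text \<open>The left side of the equivalence is the adjacency of \<open>dual_graph\<close>, so
  indexing identifies a path with the dual graph. Being an equivalence, it also forces curves that
  are not consecutive to be disjoint.\<close>

definition curve_chain :: "'f set set list \<Rightarrow> bool" where
  "curve_chain xs \<longleftrightarrow> distinct xs \<and>
     (\<forall>a<length xs. \<forall>b<length xs.
        xs ! a \<noteq> xs ! b \<and> xs ! a \<inter> xs ! b \<noteq> {} \<longleftrightarrow> b = Suc a \<or> a = Suc b)"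

lemma distinct_curve_chain: "curve_chain xs \<Longrightarrow> distinct xs"
  by (simp add: curve_chain_def)

lemma curve_chain_three:
  assumes "distinct [x, y, z]" "x \<inter> y \<noteq> {}" "y \<inter> z \<noteq> {}" "x \<inter> z = {}"
  shows "curve_chain [x, y, z]"
proof -
  \<comment> \<open>Enumerating the positions reduces the chain condition to finitely many
    pairs.\<close>
  have "n < length [x, y, z] \<longleftrightarrow> n = 0 \<or> n = 1 \<or> n = 2" for n
    by auto
  then show ?thesis
    using assms unfolding curve_chain_def by (auto simp: Int_commute)
qed

lemma keys_subchain:
  assumes "distinct xs" "j \<le> length xs"
  shows "Poly_Mapping.keys (\<Sum>v=i..<j. prime_divisor (xs ! v)) = (!) xs ` {i..<j}"
  using assms by (intro keys_sum_prime_divisor_inj) (auto simp: inj_on_def nth_eq_iff_index_eq)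

lemma has_type_subchain:
  assumes xs: "curve_chain xs" and ij: "i < j" "j \<le> length xs"
  shows "has_type (\<Sum>v=i..<j. prime_divisor (xs ! v)) [DynA (j - i)]"
proof -
  \<comment> \<open>The isomorphism is built from the diagram to the curves, where it is just
    indexing shifted by \<open>i\<close>, and reversed at the end. The index \<open>n\<close> is
    always 0, since there is a single summand.\<close>
  let ?f = "\<lambda>(n :: nat, v). xs ! (i + v)"
  have dist: "distinct xs"
    using xs by (rule distinct_curve_chain)
  have adj: "xs ! a \<noteq> xs ! b \<and> xs ! a \<inter> xs ! b \<noteq> {} \<longleftrightarrow> b = Suc a \<or> a = Suc b"
    if "a < length xs" "b < length xs" for a b
    using xs that by (simp add: curve_chain_def)
  have du: "disjoint_union_graph (map dynkin_graph [DynA (j - i)]) =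
      ({0} \<times> {..<j - i}, \<lambda>(n, v) (m, w). n = m \<and>
         snd (map dynkin_graph [DynA (j - i)] ! n) v w)"
    by (auto simp: disjoint_union_graph_def dynkin_graph_def)
  have img: "?f ` ({0} \<times> {..<j - i}) = (!) xs ` {i..<j}"
  proof (intro subset_antisym subsetI)
    fix D assume "D \<in> (!) xs ` {i..<j}"
    then obtain v where "i \<le> v" "v < j" "D = xs ! v"
      by auto
    then have "D = ?f (0, v - i)" "(0, v - i) \<in> {0} \<times> {..<j - i}"
      by auto
    then show "D \<in> ?f ` ({0} \<times> {..<j - i})"
      by blast
  qed auto
  have bij: "bij_betw ?f ({0} \<times> {..<j - i}) ((!) xs ` {i..<j})"
    unfolding bij_betw_def img using dist ij by (auto simp: inj_on_def nth_eq_iff_index_eq)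
  have "graph_iso (disjoint_union_graph (map dynkin_graph [DynA (j - i)]))
      (dual_graph (\<Sum>v=i..<j. prime_divisor (xs ! v)))"
    unfolding graph_iso_def du dual_graph_def keys_subchain[OF dist ij(2)] fst_conv snd_conv
    by (intro exI[of _ ?f] conjI bij)
      (use ij in \<open>auto simp: adj dynkin_graph_def\<close>)
  then show ?thesis
    using ij(1) by (auto simp: has_type_def intro: graph_iso_sym)
qed

text \<open>Induction on \<open>Q\<close> by adding the first run to the rest. The keys are carried
  along because they locate the curves of the rest, which is what shows that the first run does not
  meet them.\<close>

lemma has_type_separated_subchains:
  assumes xs: "curve_chain xs" and "separated_subchains xs Q"
  defines "R \<equiv> \<Sum>(i, j)\<leftarrow>Q. \<Sum>v=i..<j. prime_divisor (xs ! v)"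
  shows "Poly_Mapping.keys R = (\<Union>(i, j)\<in>set Q. (!) xs ` {i..<j}) \<and>
         has_type R (map (\<lambda>(i, j). DynA (j - i)) Q)"
  using assms(2) unfolding R_def
proof (induction Q)
  case Nil
  then show ?case by (simp add: has_type_zero)
next
  case (Cons q Q)
  obtain i j where q: "q = (i, j)" by fastforce
  define P where "P = (\<Sum>v=i..<j. prime_divisor (xs ! v))"
  define R where "R = (\<Sum>(i, j)\<leftarrow>Q. \<Sum>v=i..<j. prime_divisor (xs ! v))"
  have ij: "i < j" "j \<le> length xs" and Q: "separated_subchains xs Q"
    and later: "\<And>k l. (k, l) \<in> set Q \<Longrightarrow> j < k \<and> l \<le> length xs"
    using Cons.prems by (auto simp: separated_subchains_def q)
  have dist: "distinct xs"
    using xs by (rule distinct_curve_chain)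
  have keysP: "Poly_Mapping.keys P = (!) xs ` {i..<j}"
    unfolding P_def using dist ij(2) by (rule keys_subchain)
  have typeP: "has_type P [DynA (j - i)]"
    unfolding P_def using xs ij by (rule has_type_subchain)
  have keysR: "Poly_Mapping.keys R = (\<Union>(i, j)\<in>set Q. (!) xs ` {i..<j})"
    and typeR: "has_type R (map (\<lambda>(i, j). DynA (j - i)) Q)"
    using Cons.IH[OF Q] unfolding R_def by auto
  have apart: "D \<noteq> E \<and> D \<inter> E = {}"
    if D: "D \<in> Poly_Mapping.keys P" and E: "E \<in> Poly_Mapping.keys R" for D E
  proof -
    obtain a where a: "a < j" "D = xs ! a"
      using D unfolding keysP by auto
    obtain k l b where kl: "(k, l) \<in> set Q" and klb: "k \<le> b" "b < l" "E = xs ! b"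
      using E unfolding keysR by auto
    then have b: "j < b" "b < length xs" "E = xs ! b"
      using later[OF kl] by simp_all
    have "D \<noteq> E"
      using a b dist ij by (auto simp: nth_eq_iff_index_eq)
    moreover have "\<not> (D \<noteq> E \<and> D \<inter> E \<noteq> {})"
      using xs a b ij by (auto simp: curve_chain_def)
    ultimately show ?thesis by blast
  qed
  then have disj: "Poly_Mapping.keys P \<inter> Poly_Mapping.keys R = {}"
    by blast
  have "has_type (P + R) ([DynA (j - i)] @ map (\<lambda>(i, j). DynA (j - i)) Q)"
    using typeP typeR disj by (rule has_type_add) (use apart in blast)
  then show ?case
    using keys_add_disjoint[OF disj] by (simp add: q keysP keysR flip: P_def R_def)
qed

text \<open>Each run is charged for its own positions and for the one just after it. These blocks
  are disjoint and lie among the positions \<open>k\<close>, ..., \<open>length xs\<close>, the last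
  of which is a fictitious separator behind the end of the chain. The lower bound \<open>k\<close>
  is there for the induction.\<close>

lemma separated_subchains_total_length:
  assumes "separated_subchains xs Q" "\<And>i j. (i, j) \<in> set Q \<Longrightarrow> k \<le> i" "k \<le> Suc (length xs)"
  shows "(\<Sum>(i, j)\<leftarrow>Q. j - i) + length Q \<le> Suc (length xs) - k"
  using assms
proof (induction Q arbitrary: k)
  case Nil
  then show ?case by simp
next
  case (Cons q Q)
  obtain i j where q: "q = (i, j)" by fastforce
  have ij: "i < j" "j \<le> length xs" "k \<le> i" and Q: "separated_subchains xs Q"
    and later: "\<And>k l. (k, l) \<in> set Q \<Longrightarrow> Suc j \<le> k"
    using Cons.prems by (auto simp: separated_subchains_def q Suc_le_eq)
  \<comment> \<open>The remaining runs start beyond the separator \<open>j\<close>.\<close>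
  have "(\<Sum>(i, j)\<leftarrow>Q. j - i) + length Q \<le> Suc (length xs) - Suc j"
    using Cons.IH[OF Q later] ij by simp
  then show ?case
    using ij by (simp add: q)
qed

lemma keys_subchain_union:
  assumes "curve_chain xs" "subchain_union xs R"
  shows "Poly_Mapping.keys R \<subseteq> set xs"
proof -
  obtain Q where Q: "separated_subchains xs Q"
      "R = (\<Sum>(i, j)\<leftarrow>Q. \<Sum>v=i..<j. prime_divisor (xs ! v))"
    using assms(2) unfolding subchain_union_def by blast
  then show ?thesis
    using has_type_separated_subchains[OF assms(1) Q(1)]
    by (fastforce simp: separated_subchains_def)
qed

lemma bounded_A_type_subchain_union:
  assumes xs: "curve_chain xs" and "length xs \<le> 3" and "subchain_union xs R"
  shows "bounded_A_type R"
proof -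
  obtain Q where Q: "Q \<noteq> []" "separated_subchains xs Q"
      "R = (\<Sum>(i, j)\<leftarrow>Q. \<Sum>v=i..<j. prime_divisor (xs ! v))"
    using assms(3) unfolding subchain_union_def by blast
  define \<mu> where "\<mu> = map (\<lambda>(i, j). j - i) Q"
  have "map DynA \<mu> = map (\<lambda>(i, j). DynA (j - i)) Q"
    by (simp add: \<mu>_def case_prod_unfold)
  then have "has_type R (map DynA \<mu>)"
    using has_type_separated_subchains[OF xs Q(2)] Q(3) by simp
  \<comment> \<open>The length bound with \<open>k = 0\<close> gives at most 4; the subtracted 1 is
    the fictitious separator after the last run.\<close>
  moreover have "sum_list \<mu> + length \<mu> - 1 \<le> 3"
    using separated_subchains_total_length[OF Q(2), of 0] assms(2) by (simp add: \<mu>_def)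
  moreover have "\<forall>m\<in>set \<mu>. m \<ge> 1" "\<mu> \<noteq> []"
    using Q(1,2) by (auto simp: \<mu>_def separated_subchains_def)
  ultimately show ?thesis
    unfolding bounded_A_type_def by blast
qed

text \<open>The maximal run ending at the largest element is split off. What remains lies below the
  gap in front of that run, possibly far below \<open>n\<close>, hence strong induction.\<close>

lemma split_into_runs:
  fixes g :: "nat \<Rightarrow> 'a::comm_monoid_add"
  assumes "U \<subseteq> {..<n}"
  shows "\<exists>Q. (\<forall>(i, j)\<in>set Q. i < j \<and> j \<le> n) \<and> sorted_wrt (\<lambda>(i, j) (i', j'). j < i') Q \<and>
             sum g U = (\<Sum>(i, j)\<leftarrow>Q. \<Sum>v=i..<j. g v)"
  using assms
proof (induction n arbitrary: U rule: less_induct)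
  case (less n)
  show ?case
  proof (cases "U = {}")
    case True
    then show ?thesis by (intro exI[of _ "[]"]) simp
  next
    case False
    have fin: "finite U"
      using less.prems finite_subset by blast
    define m where "m = Max U"
    have m: "m \<in> U" "\<And>v. v \<in> U \<Longrightarrow> v \<le> m" "m < n"
      using False fin less.prems unfolding m_def by auto
    \<comment> \<open>The start of the maximal run ending at \<open>m\<close>; minimality means that
      the position before \<open>i\<close>, if there is one, is not in \<open>U\<close>.\<close>
    define i where "i = (LEAST i. {i..m} \<subseteq> U)"
    have run: "{i..m} \<subseteq> U"
      unfolding i_def by (rule LeastI[of _ m]) (simp add: m)
    have i: "i \<le> m"
      unfolding i_def by (rule Least_le) (simp add: m)
    have gap: "Suc v \<noteq> i" if "v \<in> U" for v
    proof
      assume v: "Suc v = i"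
      then have "{v..m} \<subseteq> U"
        using that run by (metis atLeastAtMost_insertL i insert_subset Suc_leD)
      then have "i \<le> v"
        unfolding i_def by (rule Least_le)
      then show False using v by simp
    qed
    have U: "U = (U \<inter> {..<i - 1}) \<union> {i..<Suc m}"
    proof (intro subset_antisym subsetI)
      fix v assume v: "v \<in> U"
      then show "v \<in> (U \<inter> {..<i - 1}) \<union> {i..<Suc m}"
        using gap[OF v] m(2)[OF v] by (cases "v < i") auto
    qed (use run in auto)
    have "i - 1 < n"
      using i m(3) by simp
    from less.IH[OF this, of "U \<inter> {..<i - 1}"] obtain Q
      where Q: "\<forall>(k, l)\<in>set Q. k < l \<and> l \<le> i - 1" "sorted_wrt (\<lambda>(i, j) (i', j'). j < i') Q"
        "sum g (U \<inter> {..<i - 1}) = (\<Sum>(i, j)\<leftarrow>Q. \<Sum>v=i..<j. g v)"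
      by auto
    have "sum g U = sum g (U \<inter> {..<i - 1}) + sum g {i..<Suc m}"
      by (subst U, rule sum.union_disjoint) auto
    then have "sum g U = (\<Sum>(i, j)\<leftarrow>Q @ [(i, Suc m)]. \<Sum>v=i..<j. g v)"
      using Q(3) by simp
    moreover have "\<forall>(k, l)\<in>set (Q @ [(i, Suc m)]). k < l \<and> l \<le> n"
      using Q(1) i m(3) by fastforce
    \<comment> \<open>An earlier run \<open>(k, l)\<close> has \<open>0 < l \<le> i - 1\<close>,
      hence \<open>l < i\<close> in spite of truncated subtraction.\<close>
    moreover have "sorted_wrt (\<lambda>(i, j) (i', j'). j < i') (Q @ [(i, Suc m)])"
      using Q(1,2) by (fastforce simp: sorted_wrt_append)
    ultimately show ?thesis by blast
  qed
qed

text \<open>The curves in \<open>B\<close> are replaced by their positions in \<open>xs\<close>, and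
  the set of positions is split into runs.\<close>

lemma subchain_union_subset:
  assumes "distinct xs" "B \<subseteq> set xs" "B \<noteq> {}"
  shows "subchain_union xs (\<Sum>D\<in>B. prime_divisor D)"
proof -
  define U where "U = {v. v < length xs \<and> xs ! v \<in> B}"
  have "inj_on ((!) xs) U"
    using assms(1) by (auto simp: U_def inj_on_def nth_eq_iff_index_eq)
  moreover have B: "B = (!) xs ` U"
    using assms(2) by (fastforce simp: U_def in_set_conv_nth)
  ultimately have sum: "(\<Sum>D\<in>B. prime_divisor D) = (\<Sum>v\<in>U. prime_divisor (xs ! v))"
    by (simp add: sum.reindex)
  have "U \<subseteq> {..<length xs}"
    by (auto simp: U_def)
  from split_into_runs[OF this, of "\<lambda>v. prime_divisor (xs ! v)"] obtain Q
    where Q: "separated_subchains xs Q"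
      "(\<Sum>D\<in>B. prime_divisor D) = (\<Sum>(i, j)\<leftarrow>Q. \<Sum>v=i..<j. prime_divisor (xs ! v))"
    unfolding sum separated_subchains_def by blast
  have "Q \<noteq> []"
  proof
    assume "Q = []"
    then have "Poly_Mapping.keys (\<Sum>D\<in>B. prime_divisor D) = {}"
      using Q(2) by simp
    then show False
      using keys_sum_prime_divisor[of B] assms(2,3) finite_subset by auto
  qed
  then show ?thesis
    using Q unfolding subchain_union_def by blast
qed

section \<open>Fibers of type III*\<close>

theorem proposition13p1:
  fixes \<iota> :: "'k::{alg_closed_field, field_char_0} \<Rightarrow> 'f::field"
    and X :: "'f set set"
    and t :: 'f
    and F :: "'f divisor"
    and C S1 M1 M2 M3 L1 L2 L3 :: "'f set set"
  assumes "field_embedding \<iota>"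
    and "K3_surface \<iota> X"
    and "elliptic_fibration \<iota> X t"
    and "singular_fiber \<iota> X t F"
    and "type_III_star \<iota> X F C S1 M1 M2 M3 L1 L2 L3"
  shows "(\<forall>R. ADER F R \<and> \<not> C \<subseteq> Supp R \<longrightarrow>
            (\<exists>!T. decomposition S1 [M1, M2, M3] [L1, L2, L3] R T) \<and>
            (\<forall>RS RM RL. decomposition S1 [M1, M2, M3] [L1, L2, L3] R (RS, RM, RL) \<longrightarrow>
               (RM \<noteq> 0 \<longrightarrow> bounded_A_type RM) \<and> (RL \<noteq> 0 \<longrightarrow> bounded_A_type RL))) \<and>
         (\<forall>R RS RM RL. R \<noteq> 0 \<and> reduced_subdivisor R F \<and> R = RS + RM + RL \<and>
            branch_parts S1 [M1, M2, M3] [L1, L2, L3] RS RM RL \<and>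
            (RM \<noteq> 0 \<longrightarrow> bounded_A_type RM) \<and> (RL \<noteq> 0 \<longrightarrow> bounded_A_type RL) \<longrightarrow>
            ADER F R)"
proof -

  \<comment> \<open>Intersection pattern of the fiber\<close>
  let ?Ms = "[M1, M2, M3]" and ?Ls = "[L1, L2, L3]"
  have dist: "distinct [C, S1, M1, M2, M3, L1, L2, L3]"
    and F: "F = Poly_Mapping.single C 4 + Poly_Mapping.single S1 2
       + Poly_Mapping.single M1 3 + Poly_Mapping.single M2 2 + Poly_Mapping.single M3 1
       + Poly_Mapping.single L1 3 + Poly_Mapping.single L2 2 + Poly_Mapping.single L3 1"
    and star: "\<forall>D \<in> Poly_Mapping.keys F. \<forall>E \<in> Poly_Mapping.keys F. snd (dual_graph F) D E \<longleftrightarrow>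
        {D, E} \<in> {{C, S1}, {C, M1}, {M1, M2}, {M2, M3}, {C, L1}, {L1, L2}, {L2, L3}}"
    using assms(5) unfolding type_III_star_def by - (elim conjE, assumption)+
  \<comment> \<open>The reversed list supplies each inequality in the opposite orientation for the
    simplifier.\<close>
  have "distinct (rev [C, S1, M1, M2, M3, L1, L2, L3])"
    using dist by (simp only: distinct_rev)
  then have rev_dist: "distinct [L3, L2, L1, M3, M2, M1, S1, C]"
    by (simp only: rev.simps append.simps)
  have S1: "S1 \<notin> set ?Ms" "S1 \<notin> set ?Ls" and MsLs: "set ?Ms \<inter> set ?Ls = {}"
    using dist rev_dist by simp_all
  have keysF: "Poly_Mapping.keys F = {C, S1, M1, M2, M3, L1, L2, L3}"
  proof (intro set_eqI)
    fix D
    show "D \<in> Poly_Mapping.keys F \<longleftrightarrow> D \<in> {C, S1, M1, M2, M3, L1, L2, L3}"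
      using dist by (auto simp: in_keys_iff F lookup_add lookup_single when_def)
  qed
  have adj: "D \<noteq> E \<and> D \<inter> E \<noteq> {} \<longleftrightarrow>
      {D, E} \<in> {{C, S1}, {C, M1}, {M1, M2}, {M2, M3}, {C, L1}, {L1, L2}, {L2, L3}}"
    if "D \<in> {C, S1, M1, M2, M3, L1, L2, L3}" "E \<in> {C, S1, M1, M2, M3, L1, L2, L3}" for D E
    using star[unfolded keysF, THEN bspec, THEN bspec, OF that] unfolding dual_graph_def snd_conv .
  have chains: "curve_chain ?Ms" "curve_chain ?Ls"
    by (rule curve_chain_three;
        use dist rev_dist adj[of M1 M2] adj[of M2 M3] adj[of M1 M3] adj[of L1 L2] adj[of L2 L3] adj[of L1 L3]
        in \<open>simp add: doubleton_eq_iff\<close>)+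
  \<comment> \<open>The two curves lie on different branches, and every edge leaving a branch ends
    at \<open>C\<close>.\<close>
  have apart: "D \<inter> E = {}"
    if "(D, E) \<in> {S1} \<times> set ?Ms \<union> {S1} \<times> set ?Ls \<union> set ?Ms \<times> set ?Ls" for D E
  proof -
    have "D = S1 \<and> (E = M1 \<or> E = M2 \<or> E = M3) \<or> D = S1 \<and> (E = L1 \<or> E = L2 \<or> E = L3) \<or>
        (D = M1 \<or> D = M2 \<or> D = M3) \<and> (E = L1 \<or> E = L2 \<or> E = L3)"
      using that by auto
    then show ?thesis
      by (elim disjE conjE; use dist rev_dist adj[of D E] in \<open>simp add: doubleton_eq_iff\<close>)
  qed

  \<comment> \<open>Components and types of the three parts\<close>
  have keys_parts: "Poly_Mapping.keys RS \<subseteq> {S1}" "Poly_Mapping.keys RM \<subseteq> set ?Ms"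
      "Poly_Mapping.keys RL \<subseteq> set ?Ls"
    if "branch_parts S1 ?Ms ?Ls RS RM RL" for RS RM RL
    using that keys_subchain_union[OF chains(1)] keys_subchain_union[OF chains(2)]
    unfolding branch_parts_def by auto
  have bounded: "(RM \<noteq> 0 \<longrightarrow> bounded_A_type RM) \<and> (RL \<noteq> 0 \<longrightarrow> bounded_A_type RL)"
    if "branch_parts S1 ?Ms ?Ls RS RM RL" for RS RM RL
    using that bounded_A_type_subchain_union[OF chains(1)] bounded_A_type_subchain_union[OF chains(2)]
    unfolding branch_parts_def by auto

  \<comment> \<open>Uniqueness of the decomposition\<close>
  have unique: "(RS, RM, RL) = (RS', RM', RL')"
    if parts: "branch_parts S1 ?Ms ?Ls RS RM RL" "branch_parts S1 ?Ms ?Ls RS' RM' RL'"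
      and eq: "RS + RM + RL = RS' + RM' + RL'" for RS RM RL RS' RM' RL'
  proof -
    have *: "Poly_Mapping.lookup RS D + Poly_Mapping.lookup RM D + Poly_Mapping.lookup RL D =
        Poly_Mapping.lookup RS' D + Poly_Mapping.lookup RM' D + Poly_Mapping.lookup RL' D" for D
      using arg_cong[OF eq, of "\<lambda>P. Poly_Mapping.lookup P D"] by (simp add: lookup_add)
    have zero: "(D \<noteq> S1 \<longrightarrow> Poly_Mapping.lookup PS D = 0) \<and>
        (D \<notin> set ?Ms \<longrightarrow> Poly_Mapping.lookup PM D = 0) \<and>
        (D \<notin> set ?Ls \<longrightarrow> Poly_Mapping.lookup PL D = 0)"
      if "branch_parts S1 ?Ms ?Ls PS PM PL" for PS PM PL D
      using keys_parts[OF that] by (auto simp: in_keys_iff subset_iff)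
    \<comment> \<open>At each curve the same two of the three coefficients vanish in both
      decompositions, so equal sums force equal third coefficients.\<close>
    have excl: "D \<noteq> S1 \<and> D \<notin> set ?Ms \<or> D \<noteq> S1 \<and> D \<notin> set ?Ls \<or> D \<notin> set ?Ms \<and> D \<notin> set ?Ls" for D
      using S1 MsLs by blast
    have "Poly_Mapping.lookup RS D = Poly_Mapping.lookup RS' D \<and>
        Poly_Mapping.lookup RM D = Poly_Mapping.lookup RM' D \<and>
        Poly_Mapping.lookup RL D = Poly_Mapping.lookup RL' D" for D
      using *[of D] zero[OF parts(1), of D] zero[OF parts(2), of D] excl[of D] by linarith
    then show ?thesis
      by (auto intro: poly_mapping_eqI)
  qed

  \<comment> \<open>Existence of the decomposition\<close>
  have exists: "\<exists>T. decomposition S1 ?Ms ?Ls R T"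
    if R: "reduced_subdivisor R F" and C: "\<not> C \<subseteq> Supp R" for R
  proof -
    obtain B where B: "B \<subseteq> {C, S1, M1, M2, M3, L1, L2, L3}" "R = (\<Sum>D\<in>B. prime_divisor D)"
      using R unfolding reduced_subdivisor_def keysF by blast
    have fin: "finite B"
      using B(1) by (rule finite_subset) simp
    \<comment> \<open>If \<open>C\<close> were a component of \<open>R\<close>, all its points would
      lie in \<open>Supp R\<close>.\<close>
    have "C \<notin> B"
      using C keys_sum_prime_divisor[OF fin] unfolding Supp_def B(2) by auto
    then have B_eq: "B = (B \<inter> {S1}) \<union> (B \<inter> set ?Ms) \<union> (B \<inter> set ?Ls)"
      using B(1) by auto
    define P where "P A = (\<Sum>D\<in>B \<inter> A. prime_divisor D)" for A
    have "(\<Sum>D\<in>B. prime_divisor D) = (\<Sum>D\<in>(B \<inter> {S1}) \<union> (B \<inter> set ?Ms). prime_divisor D) + P (set ?Ls)"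
      unfolding P_def by (subst B_eq, rule sum.union_disjoint) (use S1 MsLs fin in blast)+
    also have "(\<Sum>D\<in>(B \<inter> {S1}) \<union> (B \<inter> set ?Ms). prime_divisor D) = P {S1} + P (set ?Ms)"
      unfolding P_def by (rule sum.union_disjoint) (use S1 MsLs fin in blast)+
    finally have sum: "R = P {S1} + P (set ?Ms) + P (set ?Ls)"
      unfolding B(2) .
    have chain: "P (set xs) = 0 \<or> subchain_union xs (P (set xs))" if "curve_chain xs" for xs
      using subchain_union_subset[OF distinct_curve_chain[OF that], of "B \<inter> set xs"]
      by (cases "B \<inter> set xs = {}") (simp_all add: P_def)
    have "P {S1} \<in> {0, prime_divisor S1}"
      by (simp add: P_def Int_insert_right)
    then have "branch_parts S1 ?Ms ?Ls (P {S1}) (P (set ?Ms)) (P (set ?Ls))"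
      unfolding branch_parts_def using chain[OF chains(1)] chain[OF chains(2)] by blast
    moreover have supp: "Supp (P A) = \<Union> (B \<inter> A)" for A
      using keys_sum_prime_divisor[of "B \<inter> A"] fin by (simp add: Supp_def P_def)
    \<comment> \<open>The parts must be disjoint as point sets, not merely share no component; this
      is where \<open>apart\<close> enters.\<close>
    have "Supp (P A) \<inter> Supp (P A') = {}"
      if "A \<times> A' \<subseteq> {S1} \<times> set ?Ms \<union> {S1} \<times> set ?Ls \<union> set ?Ms \<times> set ?Ls" for A A'
      using that apart unfolding supp by blast
    from this[of "{S1}" "set ?Ms"] this[of "{S1}" "set ?Ls"] this[of "set ?Ms" "set ?Ls"]
    have "Supp (P {S1}) \<inter> Supp (P (set ?Ms)) = {}" "Supp (P {S1}) \<inter> Supp (P (set ?Ls)) = {}"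
        "Supp (P (set ?Ms)) \<inter> Supp (P (set ?Ls)) = {}"
      by blast+
    ultimately have "decomposition S1 ?Ms ?Ls R (P {S1}, P (set ?Ms), P (set ?Ls))"
      unfolding decomposition_def using sum by blast
    then show ?thesis by blast
  qed

  \<comment> \<open>Sums of branch parts have a Dynkin type\<close>
  have converse: "\<exists>Ts. has_type (RS + RM + RL) Ts"
    if parts: "branch_parts S1 ?Ms ?Ls RS RM RL" for RS RM RL
  proof -
    note keys = keys_parts[OF parts]
    \<comment> \<open>The curve \<open>S1\<close> alone is a chain of length one.\<close>
    have "has_type (prime_divisor S1) [DynA 1]"
      using has_type_subchain[of "[S1]" 0 1] by (simp add: curve_chain_def)
    then obtain TS where TS: "has_type RS TS"
      using parts has_type_zero unfolding branch_parts_def by blast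
    obtain TM where TM: "has_type RM TM"
      using bounded[OF parts] has_type_zero unfolding bounded_A_type_def by blast
    obtain TL where TL: "has_type RL TL"
      using bounded[OF parts] has_type_zero unfolding bounded_A_type_def by blast
    have disj: "Poly_Mapping.keys RS \<inter> Poly_Mapping.keys RM = {}"
      using keys S1 by blast
    have keysSM: "Poly_Mapping.keys (RS + RM) = Poly_Mapping.keys RS \<union> Poly_Mapping.keys RM"
      using disj by (rule keys_add_disjoint)
    have SM: "has_type (RS + RM) (TS @ TM)"
      using TS TM disj by (rule has_type_add) (use keys apart in blast)
    have "has_type (RS + RM + RL) ((TS @ TM) @ TL)"
    proof (rule has_type_add[OF SM TL])
      show "Poly_Mapping.keys (RS + RM) \<inter> Poly_Mapping.keys RL = {}"
        unfolding keysSM using keys S1 MsLs by blast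
      show "D \<inter> E = {}" if "D \<in> Poly_Mapping.keys (RS + RM)" "E \<in> Poly_Mapping.keys RL" for D E
      proof (rule apart)
        have "D \<in> {S1} \<union> set ?Ms" "E \<in> set ?Ls"
          using that keys unfolding keysSM by blast+
        then show "(D, E) \<in> {S1} \<times> set ?Ms \<union> {S1} \<times> set ?Ls \<union> set ?Ms \<times> set ?Ls"
          by blast
      qed
    qed
    then show ?thesis by blast
  qed

  \<comment> \<open>Both directions combined\<close>
  have parts: "branch_parts S1 ?Ms ?Ls RS RM RL \<and> R = RS + RM + RL"
    if "decomposition S1 ?Ms ?Ls R (RS, RM, RL)" for R RS RM RL
    using that unfolding decomposition_def by simp
  have "\<exists>!T. decomposition S1 ?Ms ?Ls R T" if "ADER F R" "\<not> C \<subseteq> Supp R" for R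
  proof (rule ex_ex1I)
    show "\<exists>T. decomposition S1 ?Ms ?Ls R T"
      using that exists unfolding ADER_def by blast
    show "T = T'" if "decomposition S1 ?Ms ?Ls R T" "decomposition S1 ?Ms ?Ls R T'" for T T'
      using that parts unique by (cases T; cases T') metis
  qed
  moreover have "ADER F R"
    if "R \<noteq> 0" "reduced_subdivisor R F" "R = RS + RM + RL" "branch_parts S1 ?Ms ?Ls RS RM RL"
    for R RS RM RL
    using that converse unfolding ADER_def by blast
  ultimately show ?thesis
    using parts bounded by blast
qed

end
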